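(* Let $D$ be a domain in $\mathbb C$ and let $n\geq 2$. Let $w=\pi_n(\mu)\in\mathbb C^n\setminus S_n(D)$, where $\mu=(\mu_1,\ldots,\mu_n)\in\mathbb C^n$ is such that $\mu_1\in\mathbb C\setminus D$. Then the affine hyperplane $$H(w,\mu_1):=\{(\mu_1+z_1,\ \mu_1z_1+z_2,\ \ldots,\ \mu_1z_{n-2}+z_{n-1},\ \mu_1z_{n-1}):(z_1,\ldots,z_{n-1})\in\mathbb C^{n-1}\}$$ passes through $w$ and is disjoint from $S_n(D)$. In particular, $S_n(D)$ is linearly convex.
   Context: $\pi_n:\mathbb C^n\to\mathbb C^n$ is the symmetrization map, $\pi_n(\lambda_1,\ldots,\lambda_n)=(\sigma_1(\lambda),\ldots,\sigma_n(\lambda))$, where $\sigma_j$ is the $j$-th elementary symmetric polynomial, i.e. $\prod_{j=1}^n(t-\lambda_j)=t^n+\sum_{j=1}^n(-1)^j\sigma_j(\lambda_1,\ldots,\lambda_n)t^{n-j}$. For a domain $D\subset\mathbb C$, $S_n(D):=\pi_n(D^n)$, which is a domain in $\mathbb C^n$. A domain $\Omega\subset\mathbb C^n$ is called linearly convex if for any $w\in\mathbb C^n\setminus\Omega$ there is an affine (complex) hyperplane passing through $w$ and disjoint from $\Omega$. *)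

theory Defs
  imports "HOL-Analysis.Analysis"
begin

text \<open>
  Since \<open>\<complex>\<^sup>n\<close> and \<open>\<complex>\<^sup>n\<^sup>-\<^sup>1\<close> occur side by side and coordinates are referred to by their
  position, points of \<open>\<complex>\<^sup>n\<close> are functions on \<open>nat\<close> that are extensional on \<open>{1..n}\<close>.
\<close>

definition cspace :: "nat \<Rightarrow> (nat \<Rightarrow> complex) set"
  where "cspace n = {1..n} \<rightarrow>\<^sub>E UNIV"

definition cspace_topology :: "nat \<Rightarrow> (nat \<Rightarrow> complex) topology"
  where "cspace_topology n = product_topology (\<lambda>_. euclidean) {1..n}"

lemma topspace_cspace_topology [simp]: "topspace (cspace_topology n) = cspace n"
  by (simp add: cspace_topology_def cspace_def)

definition elem_sym :: "nat \<Rightarrow> nat \<Rightarrow> (nat \<Rightarrow> complex) \<Rightarrow> complex"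
  where "elem_sym n j x = (\<Sum>J | J \<subseteq> {1..n} \<and> card J = j. \<Prod>i\<in>J. x i)"

lemma prod_diff_eq_elem_sym:
  "(\<Prod>j=1..n. t - x j) = t ^ n + (\<Sum>j=1..n. (-1) ^ j * elem_sym n j x * t ^ (n - j))"
proof -
  let ?f = "\<lambda>X. (-1) ^ card X * (\<Prod>i\<in>X. x i) * t ^ (n - card X)"
  have "(\<Prod>j=1..n. t - x j) = (\<Sum>X\<in>Pow {1..n}. (-1) ^ card X * (\<Prod>i\<in>X. x i) * (\<Prod>i\<in>{1..n} - X. t))"
    by (rule prod_diff_conv_sum) simp
  also have "\<dots> = (\<Sum>X\<in>Pow {1..n}. ?f X)"
    by (intro sum.cong refl) (auto simp: card_Diff_subset finite_subset)
  also have "\<dots> = (\<Sum>j\<in>{0..n}. \<Sum>X | X \<in> Pow {1..n} \<and> card X = j. ?f X)"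
    by (rule sum.group [symmetric]) (auto dest: card_mono [OF finite_atLeastAtMost])
  also have "\<dots> = (\<Sum>j\<in>{0..n}. (-1) ^ j * elem_sym n j x * t ^ (n - j))"
    by (intro sum.cong refl) (auto simp: elem_sym_def sum_distrib_left sum_distrib_right intro!: sum.cong)
  also have "\<dots> = (-1) ^ 0 * elem_sym n 0 x * t ^ (n - 0) +
      (\<Sum>j=1..n. (-1) ^ j * elem_sym n j x * t ^ (n - j))"
    by (subst sum.atLeast_Suc_atMost) auto
  also have "elem_sym n 0 x = 1"
  proof -
    have "{J. J \<subseteq> {1..n} \<and> card J = 0} = {{}}"
      using finite_subset by fastforce
    then show ?thesis by (simp add: elem_sym_def)
  qed
  finally show ?thesis by simp
qed

definition symmetrization :: "nat \<Rightarrow> (nat \<Rightarrow> complex) \<Rightarrow> (nat \<Rightarrow> complex)"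
  where "symmetrization n x = (\<lambda>j\<in>{1..n}. elem_sym n j x)"

definition symmetrized_power :: "nat \<Rightarrow> complex set \<Rightarrow> (nat \<Rightarrow> complex) set"
  where "symmetrized_power n D = symmetrization n ` ({1..n} \<rightarrow>\<^sub>E D)"

definition domain_in :: "'a topology \<Rightarrow> 'a set \<Rightarrow> bool"
  where "domain_in T \<Omega> \<longleftrightarrow> openin T \<Omega> \<and> connectedin T \<Omega> \<and> \<Omega> \<noteq> {}"

definition affine_hyperplane :: "nat \<Rightarrow> (nat \<Rightarrow> complex) set \<Rightarrow> bool"
  where "affine_hyperplane n H \<longleftrightarrow>
    (\<exists>a b. (\<exists>j\<in>{1..n}. a j \<noteq> 0) \<and> H = {x \<in> cspace n. (\<Sum>j=1..n. a j * x j) = b})"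

definition linearly_convex :: "nat \<Rightarrow> (nat \<Rightarrow> complex) set \<Rightarrow> bool"
  where "linearly_convex n \<Omega> \<longleftrightarrow>
    domain_in (cspace_topology n) \<Omega> \<and>
    (\<forall>w \<in> cspace n - \<Omega>. \<exists>H. affine_hyperplane n H \<and> w \<in> H \<and> H \<inter> \<Omega> = {})"

text \<open>
  The set \<open>H(w, c)\<close> depends on \<open>w\<close> only through the choice of \<open>c\<close>, so \<open>w\<close> is not an argument.
  The three branches describe \<open>(c + z\<^sub>1, c z\<^sub>1 + z\<^sub>2, \<dots>, c z\<^bsub>n-2\<^esub> + z\<^bsub>n-1\<^esub>, c z\<^bsub>n-1\<^esub>)\<close> only
  for \<open>n \<ge> 2\<close>.
\<close>

definition root_hyperplane :: "nat \<Rightarrow> complex \<Rightarrow> (nat \<Rightarrow> complex) set"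
  where "root_hyperplane n c =
    {(\<lambda>j\<in>{1..n}. if j = 1 then c + z 1
                 else if j < n then c * z (j - 1) + z j
                 else c * z (n - 1)) | z. z \<in> cspace (n - 1)}"

end

theory Submission
  imports Defs "HOL-Computational_Algebra.Fundamental_Theorem_Algebra"
begin

text \<open>
  A point \<open>w\<close> encodes the monic polynomial
  \<open>P\<^sub>w(t) = t\<^sup>n + (\<Sum>j=1..n. (-1)\<^sup>j w\<^sub>j t\<^bsup>n-j\<^esup>)\<close>. For a fixed \<open>c\<close> the equation
  \<open>P\<^sub>w(c) = 0\<close> is affine in \<open>w\<close>, and dividing by \<open>t - c\<close> shows that its solution set is
  \<open>H(w, c)\<close>. By the fundamental theorem of algebra \<open>S\<^sub>n(D)\<close> consists of the \<open>w\<close> all of whose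
  roots lie in \<open>D\<close>, so \<open>H(w, c)\<close> misses it as soon as \<open>c \<notin> D\<close>. For openness, the roots of
  polynomials with bounded coefficients stay in a fixed disc, and the set of \<open>w\<close> with a root in a
  compact set is closed, being the projection of a closed set along a compact factor.
\<close>

section \<open>Monic polynomials and their roots\<close>

definition monic_eval :: "nat \<Rightarrow> (nat \<Rightarrow> complex) \<Rightarrow> complex \<Rightarrow> complex"
  where "monic_eval n x t = t ^ n + (\<Sum>j=1..n. (-1) ^ j * x j * t ^ (n - j))"

lemma monic_eval_symmetrization: "monic_eval n (symmetrization n x) t = (\<Prod>j=1..n. t - x j)"
  unfolding prod_diff_eq_elem_sym monic_eval_def symmetrization_def
  by (intro arg_cong2 [where f = "(+)"] sum.cong) auto

lemma monic_eval_symmetrization_eq_0_iff: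
  "monic_eval n (symmetrization n x) t = 0 \<longleftrightarrow> t \<in> x ` {1..n}"
  by (auto simp: monic_eval_symmetrization)

text \<open>One step of Horner's scheme: \<open>monic_eval n\<close> reads only the entries of
  \<open>x\<close> up to \<open>n\<close>, so consecutive truncations of the same point differ by a
  multiplication by \<open>t\<close> and one new signed entry.\<close>

lemma monic_eval_Suc: "monic_eval (Suc n) x t = t * monic_eval n x t + (-1) ^ Suc n * x (Suc n)"
  by (auto simp: monic_eval_def sum_distrib_left Suc_diff_le algebra_simps intro!: sum.cong)

lemma symmetrization_in_cspace: "symmetrization n x \<in> cspace n"
  by (auto simp: symmetrization_def cspace_def)

text \<open>Agreement at every \<open>t\<close> forces equal coefficients, and entries outside
  \<open>{1..n}\<close> agree because both points are extensional. This turns identities of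
  polynomials into identities of points.\<close>

lemma monic_eval_inject:
  assumes "x \<in> cspace n" "y \<in> cspace n" and eq: "\<And>t. monic_eval n x t = monic_eval n y t"
  shows "x = y"
proof -
  \<comment> \<open>Index reversal: for \<open>i < n\<close>, \<open>c z i\<close> is the
    coefficient of \<open>t ^ i\<close>.\<close>
  define c where "c z i = (-1) ^ (n - i) * (z (n - i) :: complex)" for z i
  have *: "monic_eval n z t = t ^ n + (\<Sum>i<n. c z i * t ^ i)" for z t
    unfolding monic_eval_def c_def
    by (intro arg_cong2 [where f = "(+)"] refl sum.reindex_bij_witness [of _ "\<lambda>i. n - i" "\<lambda>i. n - i"]) auto
  have "x j = y j" if "j \<in> {1..n}" for j
  proof -
    obtain m where m: "n = Suc m"
      using \<open>j \<in> {1..n}\<close> by (cases n) auto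
    have "\<forall>t. (\<Sum>i\<le>m. c x i * t ^ i) = (\<Sum>i\<le>m. c y i * t ^ i)"
      using eq unfolding * by (simp add: m lessThan_Suc_atMost)
    then have "\<forall>i\<le>m. c x i = c y i"
      by (simp only: Transcendental.polyfun_eq_coeffs)
    then have "c x (n - j) = c y (n - j)"
      using that m by auto
    then show ?thesis
      using that by (simp add: c_def)
  qed
  then show ?thesis
    using assms(1,2) unfolding cspace_def by (intro PiE_ext) auto
qed

lemma symmetrization_surj:
  assumes "w \<in> cspace n"
  obtains x where "x \<in> cspace n" "w = symmetrization n x"
proof -
  define q where "q = (\<Sum>j=1..n. monom ((-1) ^ j * w j) (n - j))"
  define p where "p = monom 1 n + q"
  have poly_p: "poly p t = monic_eval n w t" for t
    by (simp add: p_def q_def monic_eval_def poly_monom poly_sum)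
  \<comment> \<open>Every exponent \<open>n - j\<close> in \<open>q\<close> has \<open>j\<close>
    between 1 and \<open>n\<close>, so it lies below \<open>n\<close>, and the leading term of
    \<open>p\<close> is \<open>monom 1 n\<close>.\<close>
  have coeff_q: "coeff q i = 0" if "i \<ge> n" for i
    unfolding q_def coeff_sum using that by (intro sum.neutral) auto
  have "coeff p n = 1"
    by (simp add: p_def coeff_q)
  moreover have "coeff p i = 0" if "i > n" for i
    using that by (simp add: p_def coeff_q)
  ultimately have deg: "degree p = n"
    by (metis degree_le le_antisym le_degree zero_neq_one)
  with \<open>coeff p n = 1\<close> have lead: "lead_coeff p = 1"
    by simp
  then obtain A where A: "size A = n" "p = (\<Prod>x\<in>#A. [:-x, 1:])"
    using alg_closed_imp_factorization [of p] deg by fastforce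
  obtain xs where xs: "mset xs = A"
    using ex_mset by blast
  \<comment> \<open>The roots with multiplicity, in an arbitrary order; lists are indexed from 0,
    points from 1.\<close>
  define x where "x = (\<lambda>i\<in>{1..n}. xs ! (i - 1))"
  have len: "length xs = n"
    using A(1) xs by (metis size_mset)
  have "monic_eval n (symmetrization n x) t = monic_eval n w t" for t
  proof -
    have "monic_eval n w t = (\<Prod>a\<leftarrow>xs. t - a)"
      unfolding poly_p [symmetric] A(2) xs [symmetric] by (induction xs) (auto simp: algebra_simps)
    also have "\<dots> = (\<Prod>i<n. t - xs ! i)"
      using len by (simp add: prod.list_conv_set_nth atLeast0LessThan)
    also have "\<dots> = (\<Prod>i=1..n. t - x i)"
      by (rule prod.reindex_bij_witness [of _ "\<lambda>i. i - 1" Suc]) (auto simp: x_def)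
    finally show ?thesis
      by (simp add: monic_eval_symmetrization)
  qed
  then have "symmetrization n x = w"
    using assms symmetrization_in_cspace by (intro monic_eval_inject) auto
  moreover have "x \<in> cspace n"
    by (simp add: x_def cspace_def)
  ultimately show ?thesis
    using that by blast
qed

text \<open>The entries of any preimage of \<open>w\<close> under \<open>symmetrization n\<close>
  are exactly the roots of its polynomial, so it does not matter which preimage is chosen.\<close>

lemma symmetrized_power_eq_roots:
  "symmetrized_power n D = {w \<in> cspace n. \<forall>t. monic_eval n w t = 0 \<longrightarrow> t \<in> D}"
proof (intro set_eqI iffI)
  fix w assume "w \<in> symmetrized_power n D"
  then show "w \<in> {w \<in> cspace n. \<forall>t. monic_eval n w t = 0 \<longrightarrow> t \<in> D}"
    using symmetrization_in_cspace
    by (auto simp: symmetrized_power_def monic_eval_symmetrization_eq_0_iff)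
next
  fix w assume w: "w \<in> {w \<in> cspace n. \<forall>t. monic_eval n w t = 0 \<longrightarrow> t \<in> D}"
  then obtain x where x: "x \<in> cspace n" "w = symmetrization n x"
    using symmetrization_surj by blast
  with w have "x \<in> {1..n} \<rightarrow>\<^sub>E D"
    by (auto simp: monic_eval_symmetrization_eq_0_iff cspace_def)
  with x show "w \<in> symmetrized_power n D"
    by (auto simp: symmetrized_power_def)
qed

section \<open>The hyperplane of polynomials with a prescribed root\<close>

text \<open>The parameters \<open>z\<close> are the coefficients, up to sign, of the quotient by \<open>t - c\<close>, as computed
  by Horner's scheme.\<close>

lemma root_hyperplane_eq_roots:
  assumes "n \<ge> 2"
  shows "root_hyperplane n c = {x \<in> cspace n. monic_eval n x c = 0}"
proof (intro set_eqI iffI)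
  fix x assume "x \<in> root_hyperplane n c"
  then obtain z where x: "x = (\<lambda>j\<in>{1..n}. if j = 1 then c + z 1
                 else if j < n then c * z (j - 1) + z j else c * z (n - 1))"
    by (auto simp: root_hyperplane_def)
  \<comment> \<open>Up to sign, the parameters are the partial values of Horner's scheme at
    \<open>c\<close>. The last entry of \<open>x\<close> has a form of its own, hence
    \<open>j < n\<close>; it makes the final value vanish.\<close>
  have *: "monic_eval j x c = (-1) ^ j * z j" if "j \<ge> 1" "j < n" for j
    using that
  proof (induction j rule: nat_induct_at_least)
    case base
    then show ?case by (simp add: monic_eval_def x)
  next
    case (Suc j)
    then show ?case by (simp add: monic_eval_Suc x algebra_simps)
  qed
  obtain m where m: "n = Suc m" "m \<ge> 1"
    using assms by (cases n) auto
  have "monic_eval n x c = 0"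
    using *[of m] m by (simp add: monic_eval_Suc x)
  then show "x \<in> {x \<in> cspace n. monic_eval n x c = 0}"
    by (auto simp: x cspace_def)
next
  fix x assume x: "x \<in> {x \<in> cspace n. monic_eval n x c = 0}"
  \<comment> \<open>The relation \<open>monic_eval j x c = (-1) ^ j * z j\<close> from the other
    inclusion, solved for \<open>z\<close>.\<close>
  define z where "z = (\<lambda>j\<in>{1..n-1}. (-1) ^ j * monic_eval j x c)"
  have rec: "x (Suc j) = c * ((-1) ^ j * monic_eval j x c) + (-1) ^ Suc j * monic_eval (Suc j) x c" for j
    by (simp add: monic_eval_Suc algebra_simps flip: power_mult_distrib)
  have "x = (\<lambda>j\<in>{1..n}. if j = 1 then c + z 1
                 else if j < n then c * z (j - 1) + z j else c * z (n - 1))" (is "x = ?y")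
  proof (rule PiE_ext)
    show "x \<in> {1..n} \<rightarrow>\<^sub>E UNIV" "?y \<in> {1..n} \<rightarrow>\<^sub>E UNIV"
      using x by (auto simp: cspace_def)
    fix j assume "j \<in> {1..n}"
    moreover from this have "j = Suc (j - 1)"
      by auto
    ultimately consider "j = 1" | i where "j = Suc i" "i \<ge> 1" "Suc i < n" | i where "j = Suc i" "i \<ge> 1" "Suc i = n"
      by (metis One_nat_def Suc_leI atLeastAtMost_iff le_neq_implies_less not_less_eq_eq)
    then show "x j = ?y j"
    proof cases
      case 1
      with assms have "1 \<le> n - 1" "1 \<le> n" by simp_all
      with 1 show ?thesis by (simp add: z_def monic_eval_def)
    next
      case 2
      then have "Suc i \<le> n - 1" by simp
      with 2 rec [of i] show ?thesis by (simp add: z_def)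
    next
      case 3
      \<comment> \<open>The last term of \<open>rec\<close> vanishes here because \<open>c\<close>
        is a root.\<close>
      with rec [of i] x show ?thesis by (auto simp: z_def)
    qed
  qed
  moreover have "z \<in> cspace (n - 1)"
    by (simp add: z_def cspace_def)
  ultimately show "x \<in> root_hyperplane n c"
    unfolding root_hyperplane_def by blast
qed

lemma affine_hyperplane_root_hyperplane:
  assumes "n \<ge> 2"
  shows "affine_hyperplane n (root_hyperplane n c)"
  unfolding affine_hyperplane_def
proof (intro exI conjI)
  show "\<exists>j\<in>{1..n}. (-1) ^ j * c ^ (n - j) \<noteq> 0"
    \<comment> \<open>At index \<open>n\<close> the coefficient is \<open>(-1) ^ n * c ^ 0\<close>,
      which is nonzero even for \<open>c = 0\<close>.\<close>
    using assms by (intro bexI [of _ n]) auto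
  show "root_hyperplane n c =
      {x \<in> cspace n. (\<Sum>j=1..n. (-1) ^ j * c ^ (n - j) * x j) = - (c ^ n)}"
    unfolding root_hyperplane_eq_roots [OF assms] monic_eval_def
    by (simp add: add_eq_0_iff mult_ac)
qed

section \<open>Continuity and connectedness\<close>

lemma continuous_map_cspace_euclidean:
  "continuous_map (cspace_topology n) euclidean (\<lambda>x. x)"
  unfolding euclidean_product_topology [symmetric] continuous_map_componentwise_UNIV
proof
  fix i
  show "continuous_map (cspace_topology n) euclidean (\<lambda>x. x i)"
  proof (cases "i \<in> {1..n}")
    case True
    then show ?thesis
      unfolding cspace_topology_def by (rule continuous_map_product_projection)
  next
    case False
    \<comment> \<open>Outside \<open>{1..n}\<close> every point of \<open>cspace n\<close> takes the
      value \<open>undefined\<close>, so this coordinate is constant.\<close>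
    have "continuous_map (cspace_topology n) euclidean (\<lambda>x. undefined)"
      by simp
    then show ?thesis
      by (rule continuous_map_eq) (use False in \<open>auto simp: cspace_def\<close>)
  qed
qed

text \<open>Makes the ordinary continuity rules for the function type available on
  \<open>cspace_topology n\<close>.\<close>

lemma continuous_map_cspace_compose:
  assumes "continuous_on UNIV f"
  shows "continuous_map (cspace_topology n) euclidean f"
  using continuous_map_compose [OF continuous_map_cspace_euclidean, of euclidean f n] assms
  by (simp add: o_def)

lemma continuous_map_symmetrization:
  "continuous_map (cspace_topology n) (cspace_topology n) (symmetrization n)"
proof -
  have "continuous_map (cspace_topology n) euclidean (\<lambda>x. symmetrization n x k)" if "k \<in> {1..n}" for k
  proof (rule continuous_map_cspace_compose)
    show "continuous_on UNIV (\<lambda>x. symmetrization n x k)"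
      using that by (auto simp: symmetrization_def elem_sym_def intro!: continuous_intros continuous_on_product_coordinates)
  qed
  then show ?thesis
    unfolding cspace_topology_def [of n]
    by (subst continuous_map_componentwise)
       (auto simp: symmetrization_def simp flip: cspace_topology_def)
qed

lemma connectedin_symmetrized_power:
  assumes "connected D"
  shows "connectedin (cspace_topology n) (symmetrized_power n D)"
  unfolding symmetrized_power_def
proof (rule connectedin_continuous_map_image [OF continuous_map_symmetrization])
  show "connectedin (cspace_topology n) ({1..n} \<rightarrow>\<^sub>E D)"
    using assms by (simp add: cspace_topology_def connectedin_PiE)
qed

section \<open>Openness\<close>

lemma monic_root_bound:
  assumes "n \<ge> 1" "monic_eval n w t = 0"
  shows "norm t \<le> max 1 (\<Sum>j=1..n. norm (w j))"
proof (cases "norm t \<le> 1")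
  case False
  have "t ^ n = - (\<Sum>j=1..n. (-1) ^ j * w j * t ^ (n - j))"
    using assms(2) by (simp add: monic_eval_def add_eq_0_iff2)
  then have "norm t ^ n = norm (\<Sum>j=1..n. (-1) ^ j * w j * t ^ (n - j))"
    by (metis norm_minus_cancel norm_power)
  \<comment> \<open>As \<open>norm t > 1\<close>, each \<open>norm t ^ (n - j)\<close> with
    \<open>j \<ge> 1\<close> is at most \<open>norm t ^ (n - 1)\<close>, a positive factor that is
    cancelled below.\<close>
  also have "\<dots> \<le> (\<Sum>j=1..n. norm (w j) * norm t ^ (n - 1))"
    using False
    by (intro sum_norm_le) (auto simp: norm_mult norm_power intro!: mult_left_mono power_increasing)
  also have "\<dots> = (\<Sum>j=1..n. norm (w j)) * norm t ^ (n - 1)"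
    by (simp add: sum_distrib_right)
  finally have "norm t * norm t ^ (n - 1) \<le> (\<Sum>j=1..n. norm (w j)) * norm t ^ (n - 1)"
    using assms(1) by (simp flip: power_Suc)
  then have "norm t \<le> (\<Sum>j=1..n. norm (w j))"
    by (rule mult_right_le_imp_le) (use False in \<open>intro zero_less_power, linarith\<close>)
  then show ?thesis
    by simp
qed simp

lemma closedin_monic_roots_compact:
  assumes "compact K"
  shows "closedin (cspace_topology n) {w \<in> cspace n. \<exists>t\<in>K. monic_eval n w t = 0}"
proof -
  let ?X = "prod_topology (cspace_topology n) (top_of_set K)"
  let ?Z = "{p \<in> topspace ?X. monic_eval n (fst p) (snd p) \<in> {0}}"
  \<comment> \<open>The inclusion into the product type carries the joint continuity of the
    evaluation in \<open>w\<close> and \<open>t\<close> over to \<open>?X\<close>.\<close>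
  have "continuous_map ?X euclidean (\<lambda>p. (fst p, snd p))"
    unfolding prod_topology_euclidean [symmetric] continuous_map_paired
  proof
    show "continuous_map ?X euclidean fst"
      using continuous_map_compose [OF continuous_map_fst continuous_map_cspace_euclidean]
      by (simp add: o_def)
    show "continuous_map ?X euclidean snd"
      by (rule continuous_map_into_fulltopology [OF continuous_map_snd])
  qed
  moreover have "continuous_on UNIV (\<lambda>p. monic_eval n (fst p) (snd p))"
    unfolding monic_eval_def
    by (intro continuous_intros continuous_on_product_then_coordinatewise [OF continuous_on_fst])
  ultimately have "continuous_map ?X euclidean (\<lambda>p. monic_eval n (fst p) (snd p))"
    using continuous_map_compose [of ?X euclidean "\<lambda>p. (fst p, snd p)" euclidean "\<lambda>p. monic_eval n (fst p) (snd p)"]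
    by (simp add: o_def)
  then have "closedin ?X ?Z"
    by (rule closedin_continuous_map_preimage) simp
  moreover have "closed_map ?X (cspace_topology n) fst"
    using assms by (intro Abstract_Topological_Spaces.closed_map_fst) (simp add: compact_space_subtopology)
  ultimately have "closedin (cspace_topology n) (fst ` ?Z)"
    unfolding closed_map_def by blast
  moreover have "fst ` ?Z = {w \<in> cspace n. \<exists>t\<in>K. monic_eval n w t = 0}"
    by (force simp: image_iff)
  ultimately show ?thesis
    by simp
qed

lemma openin_symmetrized_power:
  assumes "open D" "n \<ge> 1"
  shows "openin (cspace_topology n) (symmetrized_power n D)"
proof (subst openin_subopen, intro ballI)
  fix v assume v: "v \<in> symmetrized_power n D"
  \<comment> \<open>The added 1 puts \<open>v\<close> into the open set \<open>U\<close>, on which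
    all roots have norm at most \<open>max 1 M\<close>. For points of \<open>U\<close>, roots
    outside \<open>D\<close> can therefore only lie in the compact set \<open>K\<close>.\<close>
  define M where "M = (\<Sum>j=1..n. norm (v j)) + 1"
  define K where "K = cball 0 (max 1 M) - D"
  define U where "U = {w \<in> cspace n. (\<Sum>j=1..n. norm (w j)) \<in> {..<M}}"
  define V where "V = U - {w \<in> cspace n. \<exists>t\<in>K. monic_eval n w t = 0}"
  have "compact K"
    unfolding K_def using assms(1) by (intro compact_diff) auto
  have "continuous_map (cspace_topology n) euclidean (\<lambda>w. \<Sum>j=1..n. norm (w j))"
    by (intro continuous_map_cspace_compose continuous_intros continuous_on_product_coordinates)
  then have "openin (cspace_topology n) U"
    unfolding U_def using openin_continuous_map_preimage [of _ _ _ "{..<M}"] by fastforce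
  then have "openin (cspace_topology n) V"
    unfolding V_def using closedin_monic_roots_compact [OF \<open>compact K\<close>] by (rule openin_diff)
  moreover have "v \<in> V"
    using v by (auto simp: V_def U_def M_def K_def symmetrized_power_eq_roots)
  moreover have "V \<subseteq> symmetrized_power n D"
  proof
    fix w assume w: "w \<in> V"
    have "t \<in> D" if "monic_eval n w t = 0" for t
    proof -
      have "t \<in> cball 0 (max 1 M)"
        using monic_root_bound [OF assms(2) that] w by (auto simp: V_def U_def)
      with w that show ?thesis
        by (auto simp: V_def U_def K_def)
    qed
    with w show "w \<in> symmetrized_power n D"
      by (auto simp: V_def U_def symmetrized_power_eq_roots)
  qed
  ultimately show "\<exists>T. openin (cspace_topology n) T \<and> v \<in> T \<and> T \<subseteq> symmetrized_power n D"
    by blast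
qed

lemma domain_in_symmetrized_power:
  assumes "domain_in euclidean D" "n \<ge> 1"
  shows "domain_in (cspace_topology n) (symmetrized_power n D)"
  using assms openin_symmetrized_power connectedin_symmetrized_power
  by (auto simp: domain_in_def symmetrized_power_def PiE_eq_empty_iff)

theorem proposition9:
  fixes D :: "complex set" and n :: nat
  assumes "domain_in euclidean D" and "n \<ge> 2"
  shows "(\<forall>w \<mu>. w \<in> cspace n - symmetrized_power n D \<and> \<mu> \<in> cspace n \<and>
             w = symmetrization n \<mu> \<and> \<mu> 1 \<in> - D \<longrightarrow>
           affine_hyperplane n (root_hyperplane n (\<mu> 1)) \<and>
           w \<in> root_hyperplane n (\<mu> 1) \<and>
           root_hyperplane n (\<mu> 1) \<inter> symmetrized_power n D = {}) \<and>
         linearly_convex n (symmetrized_power n D)"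
proof -
  have disjoint: "root_hyperplane n c \<inter> symmetrized_power n D = {}" if "c \<notin> D" for c
    using that by (auto simp: root_hyperplane_eq_roots [OF assms(2)] symmetrized_power_eq_roots)
  have "symmetrization n \<mu> \<in> root_hyperplane n (\<mu> 1)" for \<mu>
    using assms(2) symmetrization_in_cspace
    by (auto simp: root_hyperplane_eq_roots monic_eval_symmetrization_eq_0_iff)
  moreover have "\<exists>H. affine_hyperplane n H \<and> w \<in> H \<and> H \<inter> symmetrized_power n D = {}"
    if w: "w \<in> cspace n - symmetrized_power n D" for w
  proof -
    \<comment> \<open>Taking a root outside \<open>D\<close> directly avoids reordering the entries
      of a preimage of \<open>w\<close> so that this root comes first.\<close>
    obtain c where "monic_eval n w c = 0" "c \<notin> D"
      using w by (auto simp: symmetrized_power_eq_roots)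
    with w disjoint [of c] affine_hyperplane_root_hyperplane [OF assms(2), of c] show ?thesis
      by (intro exI [of _ "root_hyperplane n c"]) (auto simp: root_hyperplane_eq_roots [OF assms(2)])
  qed
  moreover have "domain_in (cspace_topology n) (symmetrized_power n D)"
    using assms by (intro domain_in_symmetrized_power) auto
  ultimately show ?thesis
    using disjoint affine_hyperplane_root_hyperplane [OF assms(2)]
    by (auto simp: linearly_convex_def)
qed

end
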